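(* Let $(X,d)$ be an $n$-point metric space, let $A,B\ge1$ be constants, and for every $m\in\mathbb Z$ let $\phi_m:X\to L_2$ be a $1$-Lipschitz map. Then there exists a map $\varphi:X\to L_2$ such that (1) $\|\varphi\|_{\mathrm{Lip}}\le O(\sqrt{\log n\,\log(AB)})$ (with a universal implied constant), and (2) for every $x,y\in X$, $$\|\varphi(x)-\varphi(y)\|_2\ge\max_{m\in\mathbb Z}\left(\sqrt{\left\lfloor\log\frac{|B(x,2^{m+1}A)|}{|B(x,2^m/B)|}\right\rfloor}\cdot\min\left\{\frac{2^m}{B},\|\phi_m(x)-\phi_m(y)\|_2\right\}\right).$$
   Context: $L_2$ denotes a Hilbert space; $B(x,r)=\{z\in X:d(x,z)\le r\}$, $|\cdot|$ is cardinality, $\log$ is base 2.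
   Formalization: The factor log(AB) in the Lipschitz bound is replaced by max(1, log(AB)), since the stated bound fails for AB at or near 1 (two points at distance 1, A=B=1, m=-1); X is a nonempty finite set of natural numbers and L_2 is the sequence space l_2. *)

theory Defs
  imports "HOL-Analysis.Analysis"
begin

text \<open>The separable Hilbert space L_2, realised as the sequence space l_2.\<close>
definition l2_space :: "(nat \<Rightarrow> real) set" where
  "l2_space = {f. summable (\<lambda>i. (f i)\<^sup>2)}"

definition l2_dist :: "(nat \<Rightarrow> real) \<Rightarrow> (nat \<Rightarrow> real) \<Rightarrow> real" where
  "l2_dist f g = sqrt (\<Sum>i. (f i - g i)\<^sup>2)"

definition finite_metric :: "'a set \<Rightarrow> ('a \<Rightarrow> 'a \<Rightarrow> real) \<Rightarrow> bool" where
  "finite_metric X d \<longleftrightarrow> finite X \<and>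
     (\<forall>x\<in>X. \<forall>y\<in>X. d x y = 0 \<longleftrightarrow> x = y) \<and>
     (\<forall>x\<in>X. \<forall>y\<in>X. d x y = d y x) \<and>
     (\<forall>x\<in>X. \<forall>y\<in>X. \<forall>z\<in>X. d x z \<le> d x y + d y z)"

definition mball :: "'a set \<Rightarrow> ('a \<Rightarrow> 'a \<Rightarrow> real) \<Rightarrow> 'a \<Rightarrow> real \<Rightarrow> 'a set" where
  "mball X d x r = {z\<in>X. d x z \<le> r}"

definition lip_l2 :: "'a set \<Rightarrow> ('a \<Rightarrow> 'a \<Rightarrow> real) \<Rightarrow> real \<Rightarrow> ('a \<Rightarrow> nat \<Rightarrow> real) \<Rightarrow> bool" where
  "lip_l2 X d L f \<longleftrightarrow> (\<forall>x\<in>X. f x \<in> l2_space) \<and>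
     (\<forall>x\<in>X. \<forall>y\<in>X. l2_dist (f x) (f y) \<le> L * d x y)"

end

theory Submission
  imports Defs
begin

text \<open>
  Measured descent. For every integer \<open>t\<close> with \<open>1 \<le> 2^t < n\<close> let \<open>R(x,t)\<close> be the least radius
  for which \<open>B(x,R)\<close> has more than \<open>2^t\<close> points; it is 1-Lipschitz in \<open>x\<close>. With \<open>\<tau> = 2^m/B\<close>,
  the coordinate block of \<open>(t,m)\<close> is a Hilbert space truncation of \<open>\<phi>_m\<close> at height \<open>\<tau>\<close>, multiplied
  by a bump function of \<open>R(x,t)\<close> that equals 1 on \<open>[\<tau>, 2^(m+1) A]\<close> and vanishes outside the interval
  enlarged by a factor 2 at both ends. Each block is \<open>O(1)\<close>-Lipschitz, and for a given \<open>x\<close> and \<open>t\<close>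
  only \<open>O(log(AB) + 1)\<close> values of \<open>m\<close> contribute, which gives the Lipschitz bound. For given
  \<open>x\<close> and \<open>m\<close> the bump equals 1 at \<open>x\<close> for every \<open>t\<close> with
  \<open>|B(x, \<tau>)| \<le> 2^t < |B(x, 2^(m+1) A)|\<close>, and each such \<open>t\<close> contributes \<open>min(\<tau>, |\<phi>_m(x) - \<phi>_m(y)|)^2\<close>.
  The truncation is the feature map of the Gaussian kernel \<open>exp(- |\<phi>_m(x) - \<phi>_m(y)|^2 / \<tau>^2)\<close>,
  so only Gram kernels are manipulated and \<open>\<psi>\<close> is realised in \<open>l_2\<close> at the very end.
\<close>

section \<open>Gram kernels of maps into \<open>l_2\<close>, up to the Gaussian kernel\<close>

text \<open>\<open>f\<close> plays the role of a feature map. Unconditional summation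
  (\<open>has_sum\<close>) allows coordinates to be reindexed and double sums to be flattened; the
  diagonal case puts each \<open>f x\<close> in \<open>l2_space\<close>.\<close>

definition l2_kernel :: "'a set \<Rightarrow> ('a \<Rightarrow> 'a \<Rightarrow> real) \<Rightarrow> bool" where
  "l2_kernel X K \<longleftrightarrow>
     (\<exists>f::'a \<Rightarrow> nat \<Rightarrow> real. \<forall>x\<in>X. \<forall>y\<in>X. ((\<lambda>i. f x i * f y i) has_sum K x y) UNIV)"

text \<open>Coordinates move along the injection \<open>to_nat\<close>, and the positions outside
  its range are filled with 0.\<close>

lemma l2_kernel_countableI:
  fixes f :: "'a \<Rightarrow> 'i::countable \<Rightarrow> real"
  assumes "\<And>x y. x \<in> X \<Longrightarrow> y \<in> X \<Longrightarrow> ((\<lambda>i. f x i * f y i) has_sum K x y) UNIV"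
  shows "l2_kernel X K"
proof -
  define g where "g x n = (if n \<in> range (to_nat::'i \<Rightarrow> nat) then f x (from_nat n) else 0)" for x n
  have "((\<lambda>n. g x n * g y n) has_sum K x y) UNIV" if "x \<in> X" "y \<in> X" for x y
  proof -
    have "((\<lambda>n. g x n * g y n) has_sum K x y) (range (to_nat::'i \<Rightarrow> nat))"
      by (subst has_sum_reindex) (use assms[OF that] in \<open>auto simp: g_def o_def\<close>)
    thus ?thesis
      by (subst has_sum_cong_neutral[where T = "range (to_nat::'i \<Rightarrow> nat)"
            and g = "\<lambda>n. g x n * g y n"]) (auto simp: g_def)
  qed
  thus ?thesis unfolding l2_kernel_def by blast
qed

text \<open>Concatenating the feature maps gives coordinates indexed by pairs. On the diagonal the
  terms are squares, so the iterated sum controls the double one; off the diagonal |uv| \<le> u^2 +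
  v^2 gives absolute summability, and the order of summation is free.\<close>

lemma l2_kernel_has_sum:
  fixes K :: "'i::countable \<Rightarrow> 'a \<Rightarrow> 'a \<Rightarrow> real"
  assumes K: "\<And>i. l2_kernel X (K i)"
    and L: "\<And>x y. x \<in> X \<Longrightarrow> y \<in> X \<Longrightarrow> ((\<lambda>i. K i x y) has_sum L x y) UNIV"
  shows "l2_kernel X L"
proof -
  from K obtain f :: "'i \<Rightarrow> 'a \<Rightarrow> nat \<Rightarrow> real" where
    f: "\<And>i x y. x \<in> X \<Longrightarrow> y \<in> X \<Longrightarrow> ((\<lambda>j. f i x j * f i y j) has_sum K i x y) UNIV"
    unfolding l2_kernel_def by metis
  define F where "F x p = f (fst p) x (snd p)" for x p
  have sq: "(\<lambda>p. F x p * F x p) summable_on (UNIV \<times> UNIV)" if "x \<in> X" for x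
    by (rule summable_on_SigmaI[where g = "\<lambda>i. K i x x"])
       (use f[OF that that] L[OF that that] in \<open>auto simp: F_def summable_on_def\<close>)
  have "((\<lambda>p. F x p * F y p) has_sum L x y) UNIV" if "x \<in> X" "y \<in> X" for x y
  proof -
    have "(\<lambda>p. F x p * F x p + F y p * F y p) summable_on (UNIV \<times> UNIV)"
      by (intro summable_on_add sq that)
    hence "(\<lambda>p. norm (F x p * F y p)) summable_on (UNIV \<times> UNIV)"
    proof (rule Infinite_Sum.abs_summable_on_comparison_test')
      fix p
      have "0 \<le> (\<bar>F x p\<bar> - \<bar>F y p\<bar>)\<^sup>2" "0 \<le> \<bar>F x p\<bar> * \<bar>F y p\<bar>" by auto
      hence "\<bar>F x p\<bar> * \<bar>F y p\<bar> \<le> F x p * F x p + F y p * F y p"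
        unfolding power2_diff power2_abs mult.assoc power2_eq_square[symmetric] by linarith
      thus "norm (F x p * F y p) \<le> F x p * F x p + F y p * F y p"
        by (simp add: abs_mult)
    qed
    hence "(\<lambda>p. F x p * F y p) summable_on (UNIV \<times> UNIV)"
      by (rule abs_summable_summable)
    hence "((\<lambda>p. F x p * F y p) has_sum L x y) (UNIV \<times> UNIV)"
      by (intro has_sum_SigmaI[where g = "\<lambda>i. K i x y"])
         (use f[OF that] L[OF that] in \<open>auto simp: F_def\<close>)
    thus ?thesis by simp
  qed
  thus ?thesis by (rule l2_kernel_countableI)
qed

lemma l2_kernel_cong:
  "l2_kernel X K \<Longrightarrow> (\<And>x y. x \<in> X \<Longrightarrow> y \<in> X \<Longrightarrow> K x y = L x y) \<Longrightarrow> l2_kernel X L"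
  unfolding l2_kernel_def by metis

lemma l2_kernel_rank1: "l2_kernel X (\<lambda>x y. g x * g y)"
proof (rule l2_kernel_countableI)
  show "((\<lambda>i::unit. g x * g y) has_sum g x * g y) UNIV" for x y
    by (rule has_sum_finiteI) auto
qed

text \<open>The feature vector of \<open>x\<close> is multiplied by the scalar
  \<open>g x\<close>.\<close>

lemma l2_kernel_scale:
  assumes "l2_kernel X K"
  shows "l2_kernel X (\<lambda>x y. g x * g y * K x y)"
proof -
  from assms obtain f :: "'a \<Rightarrow> nat \<Rightarrow> real" where
    f: "\<And>x y. x \<in> X \<Longrightarrow> y \<in> X \<Longrightarrow> ((\<lambda>i. f x i * f y i) has_sum K x y) UNIV"
    unfolding l2_kernel_def by blast
  show ?thesis
  proof (rule l2_kernel_countableI)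
    fix x y assume "x \<in> X" "y \<in> X"
    from has_sum_cmult_right[OF f[OF this], of "g x * g y"]
    show "((\<lambda>i. (g x * f x i) * (g y * f y i)) has_sum g x * g y * K x y) UNIV"
      by (simp add: mult_ac)
  qed
qed

lemma l2_kernel_cmult:
  assumes "l2_kernel X K" "c \<ge> 0"
  shows "l2_kernel X (\<lambda>x y. c * K x y)"
  by (rule l2_kernel_cong[OF l2_kernel_scale[OF assms(1), of "\<lambda>_. sqrt c"]]) (use assms(2) in auto)

text \<open>Schur product: expanding \<open>K\<close> into its rank-one pieces turns the product
  into a sum of rescalings of \<open>L\<close>.\<close>

lemma l2_kernel_mult:
  assumes "l2_kernel X K" "l2_kernel X L"
  shows "l2_kernel X (\<lambda>x y. K x y * L x y)"
proof -
  from assms(1) obtain f :: "'a \<Rightarrow> nat \<Rightarrow> real" where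
    f: "\<And>x y. x \<in> X \<Longrightarrow> y \<in> X \<Longrightarrow> ((\<lambda>i. f x i * f y i) has_sum K x y) UNIV"
    unfolding l2_kernel_def by blast
  show ?thesis
    by (rule l2_kernel_has_sum[where K = "\<lambda>i x y. f x i * f y i * L x y"])
       (intro l2_kernel_scale assms(2) has_sum_cmult_left f)+
qed

lemma l2_kernel_power:
  assumes "l2_kernel X K"
  shows "l2_kernel X (\<lambda>x y. K x y ^ k)"
proof (induction k)
  case 0
  show ?case using l2_kernel_rank1[of X "\<lambda>_. 1"] by simp
next
  case (Suc k)
  show ?case using l2_kernel_mult[OF assms Suc.IH] by simp
qed

text \<open>The exponential series has nonnegative coefficients, so it is a convergent sum of
  kernels.\<close>

lemma l2_kernel_exp:
  assumes "l2_kernel X K"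
  shows "l2_kernel X (\<lambda>x y. exp (K x y))"
proof (rule l2_kernel_has_sum[where K = "\<lambda>k x y. (1 / fact k) * K x y ^ k"])
  show "l2_kernel X (\<lambda>x y. (1 / fact k) * K x y ^ k)" for k
    by (intro l2_kernel_cmult l2_kernel_power assms) auto
  fix x y
  have "summable (\<lambda>k. norm (K x y ^ k /\<^sub>R fact k))" by (rule summable_norm_exp)
  from norm_summable_imp_has_sum[OF this exp_converges]
  show "((\<lambda>k. (1 / fact k) * K x y ^ k) has_sum exp (K x y)) UNIV"
    by (simp add: divide_inverse)
qed

lemma l2_kernel_sum:
  fixes K :: "'i::countable \<Rightarrow> 'a \<Rightarrow> 'a \<Rightarrow> real"
  assumes "finite S" "\<And>i. i \<in> S \<Longrightarrow> l2_kernel X (K i)"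
  shows "l2_kernel X (\<lambda>x y. \<Sum>i\<in>S. K i x y)"
proof (rule l2_kernel_has_sum[where K = "\<lambda>i x y. if i \<in> S then K i x y else 0"])
  show "l2_kernel X (\<lambda>x y. if i \<in> S then K i x y else 0)" for i
    using assms(2)[of i] l2_kernel_rank1[of X "\<lambda>_. 0"] by (cases "i \<in> S") auto
  show "((\<lambda>i. if i \<in> S then K i x y else 0) has_sum (\<Sum>i\<in>S. K i x y)) UNIV" for x y
    by (rule has_sum_finite_neutralI[OF assms(1)]) auto
qed

lemma l2_space_summable_mult:
  assumes "f \<in> l2_space" "g \<in> l2_space"
  shows "(\<lambda>i. f i * g i) summable_on UNIV"
proof (rule norm_summable_imp_summable_on, rule summable_comparison_test')
  show "summable (\<lambda>i. (f i)\<^sup>2 + (g i)\<^sup>2)"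
    using assms by (auto simp: l2_space_def intro: summable_add)
  fix i
  have "0 \<le> (\<bar>f i\<bar> - \<bar>g i\<bar>)\<^sup>2" "0 \<le> \<bar>f i\<bar> * \<bar>g i\<bar>" by auto
  hence "\<bar>f i\<bar> * \<bar>g i\<bar> \<le> (f i)\<^sup>2 + (g i)\<^sup>2"
    unfolding power2_diff power2_abs mult.assoc by linarith
  thus "norm (norm (f i * g i)) \<le> (f i)\<^sup>2 + (g i)\<^sup>2"
    by (simp add: abs_mult)
qed

lemma l2_dist_has_sum:
  assumes "((\<lambda>i. f i * f i) has_sum a) UNIV" "((\<lambda>i. f i * g i) has_sum b) UNIV"
    "((\<lambda>i. g i * g i) has_sum c) UNIV"
  shows "(l2_dist f g)\<^sup>2 = a - 2 * b + c"
proof -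
  have "((\<lambda>i. f i * f i + (-2) * (f i * g i) + g i * g i) has_sum a + (-2) * b + c) UNIV"
    by (intro has_sum_add has_sum_cmult_right assms)
  hence "((\<lambda>i. (f i - g i)\<^sup>2) has_sum a - 2 * b + c) UNIV"
    by (simp add: power2_diff power2_eq_square algebra_simps)
  \<comment> \<open>The sign is needed to undo the square root in \<open>l2_dist\<close>.\<close>
  moreover from this have "0 \<le> a - 2 * b + c" by (rule has_sum_nonneg) auto
  ultimately show ?thesis
    unfolding l2_dist_def by (metis has_sum_imp_sums real_sqrt_pow2 sums_unique)
qed

lemma l2_kernel_realize:
  assumes "l2_kernel X K"
  obtains \<psi> :: "'a \<Rightarrow> nat \<Rightarrow> real" where "\<And>x. x \<in> X \<Longrightarrow> \<psi> x \<in> l2_space"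
    "\<And>x y. x \<in> X \<Longrightarrow> y \<in> X \<Longrightarrow> (l2_dist (\<psi> x) (\<psi> y))\<^sup>2 = K x x - 2 * K x y + K y y"
proof -
  from assms obtain f :: "'a \<Rightarrow> nat \<Rightarrow> real" where
    f: "\<And>x y. x \<in> X \<Longrightarrow> y \<in> X \<Longrightarrow> ((\<lambda>i. f x i * f y i) has_sum K x y) UNIV"
    unfolding l2_kernel_def by blast
  show ?thesis
  proof
    show "f x \<in> l2_space" if "x \<in> X" for x
      using has_sum_imp_sums[OF f[OF that that]]
      by (auto simp: l2_space_def power2_eq_square sums_iff)
    show "(l2_dist (f x) (f y))\<^sup>2 = K x x - 2 * K x y + K y y" if "x \<in> X" "y \<in> X" for x y
      by (intro l2_dist_has_sum f that)
  qed
qed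

text \<open>Expanding |u - v|^2 writes the Gaussian as exp(-c|u|^2) exp(-c|v|^2) exp(2c<u,v>), a
  rescaled exponential of the inner product kernel.\<close>

lemma l2_kernel_gaussian:
  assumes "\<And>x. x \<in> X \<Longrightarrow> f x \<in> l2_space" and "c \<ge> 0"
  shows "l2_kernel X (\<lambda>x y. exp (- c * (l2_dist (f x) (f y))\<^sup>2))"
proof -
  define K where "K x y = (\<Sum>\<^sub>\<infinity>i. f x i * f y i)" for x y
  have K: "((\<lambda>i. f x i * f y i) has_sum K x y) UNIV" if "x \<in> X" "y \<in> X" for x y
    unfolding K_def by (intro has_sum_infsum l2_space_summable_mult assms that)
  have "l2_kernel X K"
    by (rule l2_kernel_countableI) (rule K)
  hence "l2_kernel X (\<lambda>x y. exp (- c * K x x) * exp (- c * K y y) * exp (2 * c * K x y))"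
    by (intro l2_kernel_scale[where g = "\<lambda>x. exp (- c * K x x)"] l2_kernel_exp l2_kernel_cmult)
       (use assms(2) in auto)
  thus ?thesis
    by (rule l2_kernel_cong)
       (simp add: l2_dist_has_sum[OF K K K] mult_exp_exp algebra_simps)
qed

text \<open>Since exp(-u) \<le> 1/(1+u), the right side is at least 2u/(1+u), which dominates
  min(1,u).\<close>

lemma one_minus_exp_ge:
  fixes u :: real
  assumes "u \<ge> 0"
  shows "min 1 u \<le> 2 * (1 - exp (- u))"
proof -
  have "exp (- u) \<le> 1 / (1 + u)"
    using exp_ge_add_one_self[of u] assms
    by (auto simp: exp_minus field_simps)
  moreover have "min 1 u \<le> 2 * (1 - 1 / (1 + u))"
    using assms mult_left_le[of u u] by (auto simp: field_simps min_def)
  ultimately have "min 1 u \<le> 2 * (1 - 1 / (1 + u))" "exp (- u) \<le> 1 / (1 + u)" by simp_all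
  thus ?thesis by argo
qed

section \<open>Critical radii and the counting of scales\<close>

text \<open>As a function of the radius, the ball size jumps only at the finitely many distances
  from \<open>x\<close>, so the least admissible radius is attained. The equivalence is the only
  property of \<open>R\<close> used later, besides positivity.\<close>

lemma critical_radius:
  assumes "finite_metric X d" "x \<in> X" "t < card X" "t > 0"
  obtains R where "R > 0" "\<And>r. R \<le> r \<longleftrightarrow> t < card (mball X d x r)"
proof -
  have fin: "finite X" using assms(1) by (simp add: finite_metric_def)
  have mono: "card (mball X d x r) \<le> card (mball X d x s)" if "r \<le> s" for r s
    using that fin by (intro card_mono) (auto simp: mball_def)
  define S where "S = {r \<in> d x ` X. t < card (mball X d x r)}"
  have "finite S" using fin by (simp add: S_def)
  have "mball X d x (Max (d x ` X)) = X" using fin by (auto simp: mball_def)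
  hence "Max (d x ` X) \<in> S" using fin assms by (auto simp: S_def intro!: Max_in)
  hence "S \<noteq> {}" by auto
  define R where "R = Min S"
  have RS: "R \<in> S" unfolding R_def using \<open>finite S\<close> \<open>S \<noteq> {}\<close> by (rule Min_in)
  have iff: "R \<le> r \<longleftrightarrow> t < card (mball X d x r)" for r
  proof
    assume "R \<le> r" thus "t < card (mball X d x r)" using RS mono[of R r] by (auto simp: S_def)
  next
    assume r: "t < card (mball X d x r)"
    hence ne: "mball X d x r \<noteq> {}" by auto
    have finb: "finite (mball X d x r)" using fin by (simp add: mball_def)
    \<comment> \<open>Shrinking \<open>r\<close> to the largest distance realised inside the ball
      leaves the ball unchanged and yields a member of \<open>S\<close>.\<close>
    define s where "s = Max (d x ` mball X d x r)"
    have s: "s \<in> d x ` mball X d x r" unfolding s_def using ne finb by (intro Max_in) auto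
    have "mball X d x s = mball X d x r"
      using s finb by (auto simp: mball_def s_def intro!: Max_ge)
    hence "s \<in> S" using s r by (auto simp: S_def mball_def)
    hence "R \<le> s" using \<open>finite S\<close> by (simp add: R_def)
    also have "s \<le> r" using s by (auto simp: mball_def)
    finally show "R \<le> r" .
  qed
  \<comment> \<open>A ball of radius 0 has at most one point, hence not more than \<open>t\<close>,
    which rules out \<open>R \<le> 0\<close>.\<close>
  have "mball X d x 0 \<subseteq> {x}"
  proof
    fix z assume "z \<in> mball X d x 0"
    hence z: "z \<in> X" "d x z \<le> 0" by (auto simp: mball_def)
    have "d x x \<le> d x z + d z x" "d z x = d x z" "d x x = 0"
      using assms(1,2) z unfolding finite_metric_def by blast+
    hence "d x z = 0" using z by linarith
    thus "z \<in> {x}" using assms(1,2) z unfolding finite_metric_def by auto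
  qed
  hence "card (mball X d x 0) \<le> card {x}" by (intro card_mono) auto
  hence "R > 0" using iff[of 0] assms(4) by auto
  thus ?thesis using iff that by blast
qed

lemma card_int_between:
  fixes a b :: real
  assumes "a \<le> b"
  shows "finite {m::int. a < m \<and> m < b}" and "real (card {m::int. a < m \<and> m < b}) \<le> b - a + 1"
proof -
  have eq: "{m::int. a < m \<and> m < b} = {\<lfloor>a\<rfloor> + 1..\<lceil>b\<rceil> - 1}"
  proof (intro set_eqI)
    fix m :: int
    have "a < m \<longleftrightarrow> \<lfloor>a\<rfloor> + 1 \<le> m" "m < b \<longleftrightarrow> m \<le> \<lceil>b\<rceil> - 1"
      by (linarith, simp add: less_ceiling_iff[symmetric])
    thus "m \<in> {m. a < m \<and> m < b} \<longleftrightarrow> m \<in> {\<lfloor>a\<rfloor> + 1..\<lceil>b\<rceil> - 1}" by simp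
  qed
  show "finite {m::int. a < m \<and> m < b}" unfolding eq by simp
  show "real (card {m::int. a < m \<and> m < b}) \<le> b - a + 1"
    unfolding eq card_atLeastAtMost_int using assms by linarith
qed

text \<open>The exponents form the half-open range from ceil(log p) to ceil(log q), and ceil(v) -
  ceil(u) \<ge> floor(v - u) for all reals u, v.\<close>

lemma card_powers_between:
  fixes p q :: nat
  assumes "p > 0" "q > 0" and S: "\<And>t. p \<le> 2 ^ t \<Longrightarrow> 2 ^ t < q \<Longrightarrow> t \<in> S" and "finite S"
  shows "\<lfloor>log 2 (real q / real p)\<rfloor> \<le> int (card S)"
proof -
  define a b where "a = nat \<lceil>log 2 p\<rceil>" and "b = nat \<lceil>log 2 q\<rceil>"
  have "{a..<b} \<subseteq> S"
  proof
    fix t assume t: "t \<in> {a..<b}"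
    have "log 2 p \<le> t" using t by (auto simp: a_def)
    moreover have "t < log 2 q" using t by (auto simp: b_def) linarith
    ultimately have "real p \<le> 2 powr t" "2 powr t < real q"
      using assms(1,2) by (simp_all add: log_le_iff less_log_iff)
    hence "real p \<le> real (2 ^ t)" "real (2 ^ t) < real q" by (simp_all add: powr_realpow)
    thus "t \<in> S" by (intro S) (simp_all only: of_nat_le_iff of_nat_less_iff)
  qed
  hence "b - a \<le> card S" using card_mono[OF assms(4), of "{a..<b}"] by simp
  moreover have "0 \<le> log 2 p" "0 \<le> log 2 q" using assms(1,2) by auto
  hence "int a = \<lceil>log 2 p\<rceil>" "int b = \<lceil>log 2 q\<rceil>" unfolding a_def b_def by auto
  moreover have "log 2 (real q / real p) = log 2 q - log 2 p"
    using assms(1,2) by (simp add: log_divide)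
  ultimately show ?thesis by linarith
qed

section \<open>The bump function\<close>

text \<open>For 0 < a \<le> b this is a trapezoid: it rises linearly on [a/2, a], equals 1 on [a, b]
  and falls linearly on [b, 2b].\<close>

definition bump :: "real \<Rightarrow> real \<Rightarrow> real \<Rightarrow> real" where
  "bump a b r = max 0 (min 1 (min (2 * r / a - 1) (2 - r / b)))"

lemma bump_range: "0 \<le> bump a b r" "bump a b r \<le> 1"
  by (auto simp: bump_def)

lemma bump_eq_1:
  assumes "0 < a" "a \<le> r" "r \<le> b"
  shows "bump a b r = 1"
proof -
  have "1 \<le> 2 * r / a - 1" "1 \<le> 2 - r / b" using assms by (auto simp: field_simps)
  thus ?thesis by (simp add: bump_def)
qed

lemma bump_support:
  assumes "0 < a" "a \<le> b" "bump a b r \<noteq> 0"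
  shows "a / 2 < r" "r < 2 * b"
proof -
  have "0 < 2 * r / a - 1" "0 < 2 - r / b" using assms(3) by (auto simp: bump_def max_def split: if_splits)
  thus "a / 2 < r" "r < 2 * b" using assms(1,2) by (auto simp: field_simps)
qed

lemma abs_max_min_le:
  fixes u v u' v' :: real
  shows "\<bar>max 0 (min 1 (min u v)) - max 0 (min 1 (min u' v'))\<bar> \<le> max \<bar>u - u'\<bar> \<bar>v - v'\<bar>"
proof -
  have "\<bar>max 0 (min 1 w) - max 0 (min 1 w')\<bar> \<le> \<bar>w - w'\<bar>" for w w' :: real
    by (auto simp: max_def min_def)
  moreover have "\<bar>min u v - min u' v'\<bar> \<le> max \<bar>u - u'\<bar> \<bar>v - v'\<bar>"
    by (auto simp: max_def min_def)
  ultimately show ?thesis by (rule order_trans)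
qed

text \<open>The two slopes are 2/a and 1/b, and the first dominates because a \<le> b. With a =
  \<open>\<tau>\<close>, the factor \<open>\<tau>\<close> of a block cancels this constant.\<close>

lemma bump_lipschitz:
  assumes "0 < a" "a \<le> b" "\<bar>r - s\<bar> \<le> \<delta>"
  shows "\<bar>bump a b r - bump a b s\<bar> \<le> 2 / a * \<delta>"
proof -
  have "\<bar>bump a b r - bump a b s\<bar> \<le> max \<bar>2 * r / a - 2 * s / a\<bar> \<bar>r / b - s / b\<bar>"
    unfolding bump_def
    by (rule order_trans[OF abs_max_min_le]) (simp add: abs_minus_commute)
  also have "\<dots> \<le> 2 / a * \<bar>r - s\<bar>"
  proof -
    have "2 * r / a - 2 * s / a = 2 / a * (r - s)" "r / b - s / b = 1 / b * (r - s)"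
      by (simp_all add: right_diff_distrib diff_divide_distrib)
    hence "\<bar>2 * r / a - 2 * s / a\<bar> = 2 / a * \<bar>r - s\<bar>" "\<bar>r / b - s / b\<bar> = 1 / b * \<bar>r - s\<bar>"
      using assms(1,2) by (simp_all only: abs_mult abs_of_pos divide_pos_pos zero_less_numeral zero_less_one less_le_trans[OF assms(1,2)])
    moreover have "1 / b \<le> 2 / a" using assms(1,2) by (simp add: field_simps)
    hence "1 / b * \<bar>r - s\<bar> \<le> 2 / a * \<bar>r - s\<bar>" by (intro mult_right_mono) auto
    ultimately show ?thesis by simp
  qed
  also have "\<dots> \<le> 2 / a * \<delta>" using assms by (intro mult_left_mono) auto
  finally show ?thesis .
qed

section \<open>Two-sided estimates for a single block\<close>

lemma damped_gaussian_upper: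
  fixes a b \<tau> D \<delta> :: real
  assumes "\<tau> > 0" "0 \<le> a" "a \<le> 1" "0 \<le> b" "b \<le> 1" "\<bar>a - b\<bar> \<le> 2 / \<tau> * \<delta>" "0 \<le> D" "D \<le> \<delta>"
  shows "2 * \<tau>\<^sup>2 * (a\<^sup>2 - 2 * (a * b * exp (- (1 / \<tau>\<^sup>2) * D\<^sup>2)) + b\<^sup>2) \<le> 12 * \<delta>\<^sup>2"
proof -
  define q where "q = 1 - exp (- (1 / \<tau>\<^sup>2) * D\<^sup>2)"
  have q: "0 \<le> q" "q \<le> D\<^sup>2 / \<tau>\<^sup>2"
    using exp_ge_add_one_self[of "- (1 / \<tau>\<^sup>2) * D\<^sup>2"] by (auto simp: q_def)
  have "\<tau>\<^sup>2 * q \<le> D\<^sup>2" using q assms(1) by (simp add: field_simps)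
  also have "D\<^sup>2 \<le> \<delta>\<^sup>2" using assms by (intro power_mono)
  finally have 1: "\<tau>\<^sup>2 * q \<le> \<delta>\<^sup>2" .
  have "\<tau> * \<bar>a - b\<bar> \<le> 2 * \<delta>" using assms(1,6) by (simp add: field_simps)
  hence "(\<tau> * \<bar>a - b\<bar>)\<^sup>2 \<le> (2 * \<delta>)\<^sup>2" using assms(1) by (intro power_mono) auto
  hence 2: "\<tau>\<^sup>2 * (a - b)\<^sup>2 \<le> 4 * \<delta>\<^sup>2" by (simp add: power_mult_distrib)
  have "a * b \<le> 1" using assms by (intro mult_le_one) auto
  hence "a * b * (\<tau>\<^sup>2 * q) \<le> 1 * \<delta>\<^sup>2" using 1 q assms by (intro mult_mono) auto
  \<comment> \<open>The squared distance splits into a radial part, at most 2 * 4 \<delta>^2, and an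
    angular part, at most 4 \<delta>^2; this is the source of 12.\<close>
  moreover have "2 * \<tau>\<^sup>2 * (a\<^sup>2 - 2 * (a * b * (1 - q)) + b\<^sup>2)
      = 2 * (\<tau>\<^sup>2 * (a - b)\<^sup>2) + 4 * (a * b * (\<tau>\<^sup>2 * q))"
    by (simp add: power2_eq_square algebra_simps)
  ultimately show ?thesis using 2 by (simp add: q_def)
qed

text \<open>All Gaussian feature vectors lie on one sphere, so rescaling one of the two by
  \<open>b \<le> 1\<close> cannot bring them much closer together.\<close>

lemma damped_gaussian_lower:
  fixes b \<tau> D :: real
  assumes "\<tau> > 0" "0 \<le> b" "b \<le> 1" "0 \<le> D"
  shows "(min \<tau> D)\<^sup>2 \<le> 2 * \<tau>\<^sup>2 * (1 - 2 * (b * exp (- (1 / \<tau>\<^sup>2) * D\<^sup>2)) + b\<^sup>2)"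
proof -
  define e where "e = exp (- (1 / \<tau>\<^sup>2) * D\<^sup>2)"
  have e: "0 \<le> e" "e \<le> 1" by (auto simp: e_def)
  have "(min \<tau> D)\<^sup>2 = \<tau>\<^sup>2 * min 1 (D\<^sup>2 / \<tau>\<^sup>2)"
  proof (cases "\<tau> \<le> D")
    case True
    hence "\<tau>\<^sup>2 \<le> D\<^sup>2" using assms by (intro power_mono) auto
    thus ?thesis using True assms(1) by (simp add: min_def field_simps)
  next
    case False
    hence "D\<^sup>2 \<le> \<tau>\<^sup>2" using assms by (intro power_mono) auto
    thus ?thesis using False assms(1) by (auto simp: min_def field_simps)
  qed
  also have "\<dots> \<le> \<tau>\<^sup>2 * (2 * (1 - e))"
    using one_minus_exp_ge[of "D\<^sup>2 / \<tau>\<^sup>2"] by (intro mult_left_mono) (auto simp: e_def)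
  also have "\<dots> = 2 * \<tau>\<^sup>2 * (1 - e)" by simp
  \<comment> \<open>The difference of the two sides is (b - e)^2 + e(1 - e).\<close>
  also have "1 - e \<le> 1 - 2 * (b * e) + b\<^sup>2"
  proof -
    have "0 \<le> (b - e)\<^sup>2 + e * (1 - e)" using e by auto
    thus ?thesis by (simp add: power2_eq_square algebra_simps)
  qed
  finally show ?thesis unfolding e_def by (simp add: mult_left_mono)
qed

section \<open>Nonnegative distances, Lipschitz critical radii and active scales\<close>

lemma l2_dist_self [simp]: "l2_dist f f = 0"
  by (simp add: l2_dist_def)

text \<open>Membership in \<open>l2_space\<close> makes the series converge; without convergence
  \<open>suminf\<close> has no known sign.\<close>

lemma l2_dist_nonneg:
  assumes "f \<in> l2_space" "g \<in> l2_space"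
  shows "0 \<le> l2_dist f g"
proof -
  have "summable (\<lambda>i. (f i - g i)\<^sup>2)"
  proof (rule summable_comparison_test')
    show "summable (\<lambda>i. 2 * (f i)\<^sup>2 + 2 * (g i)\<^sup>2)"
      using assms by (auto simp: l2_space_def intro!: summable_add summable_mult)
    fix i
    have "0 \<le> (f i + g i)\<^sup>2" by simp
    hence "(f i - g i)\<^sup>2 \<le> 2 * (f i)\<^sup>2 + 2 * (g i)\<^sup>2"
      unfolding power2_diff power2_sum by linarith
    thus "norm ((f i - g i)\<^sup>2) \<le> 2 * (f i)\<^sup>2 + 2 * (g i)\<^sup>2" by simp
  qed
  thus ?thesis by (simp add: l2_dist_def suminf_nonneg)
qed


text \<open>By the triangle inequality the critical ball of \<open>x\<close> lies in the ball around
  \<open>y\<close> whose radius is larger by \<open>d x y\<close>.\<close>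

lemma critical_radius_lipschitz:
  assumes "finite_metric X d" "x \<in> X" "y \<in> X"
    and Rx: "\<And>r. Rx \<le> r \<longleftrightarrow> t < card (mball X d x r)"
    and Ry: "\<And>r. Ry \<le> r \<longleftrightarrow> t < card (mball X d y r)"
  shows "Ry \<le> Rx + d x y"
proof -
  have "mball X d x Rx \<subseteq> mball X d y (Rx + d x y)"
  proof
    fix z assume "z \<in> mball X d x Rx"
    hence z: "z \<in> X" "d x z \<le> Rx" by (auto simp: mball_def)
    have "d y z \<le> d y x + d x z" "d y x = d x y"
      using assms(1-3) z unfolding finite_metric_def by blast+
    thus "z \<in> mball X d y (Rx + d x y)" using z by (auto simp: mball_def)
  qed
  moreover have "finite (mball X d y (Rx + d x y))"
    using assms(1) by (simp add: finite_metric_def mball_def)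
  ultimately have "card (mball X d x Rx) \<le> card (mball X d y (Rx + d x y))"
    by (rule card_mono[rotated])
  moreover have "t < card (mball X d x Rx)" using Rx by blast
  ultimately show ?thesis using Ry by (meson less_le_trans)
qed

text \<open>A nonzero bump forces R/(4A) < 2^m < 2BR, an open window for \<open>m\<close> of length
  log(AB) + 3. It holds at most log(AB) + 4 integers, whence the factor 5.\<close>

lemma card_active_scales:
  fixes A B R :: real
  assumes "A \<ge> 1" "B \<ge> 1" "R > 0"
  defines "S \<equiv> {m::int. bump (2 powr m / B) (2 powr (m + 1) * A) R \<noteq> 0}"
  shows "finite S" "real (card S) \<le> 5 * max 1 (log 2 (A * B))"
proof -
  let ?a = "log 2 R - log 2 A - 2" and ?b = "log 2 R + log 2 B + 1"
  have nn: "0 \<le> log 2 A" "0 \<le> log 2 B" using assms by auto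
  have sub: "S \<subseteq> {m::int. ?a < m \<and> m < ?b}"
  proof
    fix m assume "m \<in> S"
    hence m: "bump (2 powr m / B) (2 powr (m + 1) * A) R \<noteq> 0" by (simp add: S_def)
    have "2 powr m / B \<le> 2 powr m * 1" using assms by (simp add: field_simps)
    also have "\<dots> \<le> 2 powr (m + 1) * A" using assms by (intro mult_mono) auto
    finally have "2 powr m / B / 2 < R" "R < 2 * (2 powr (m + 1) * A)"
      using bump_support[OF _ _ m] assms by auto
    hence "2 powr m < 2 * B * R" "R < 4 * A * 2 powr m"
      using assms by (auto simp: field_simps powr_add)
    hence "log 2 (2 powr m) < log 2 (2 * B * R)" "log 2 R < log 2 (4 * A * 2 powr m)"
      by (intro log_less; use assms in simp)+
    moreover have "log 2 (4::real) = 2" using log_pow_cancel[of "2::real" 2] by simp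
    ultimately show "m \<in> {m::int. ?a < m \<and> m < ?b}"
      using assms by (auto simp: log_mult)
  qed
  have ab: "?a \<le> ?b" using nn by linarith
  show "finite S" using finite_subset[OF sub card_int_between(1)[OF ab]] .
  have "real (card S) \<le> real (card {m::int. ?a < m \<and> m < ?b})"
    using card_mono[OF card_int_between(1)[OF ab] sub] by simp
  also have "\<dots> \<le> ?b - ?a + 1" using card_int_between(2)[OF ab] .
  also have "\<dots> = log 2 (A * B) + 4" using assms by (simp add: log_mult)
  finally show "real (card S) \<le> 5 * max 1 (log 2 (A * B))" by linarith
qed

section \<open>Assembly of the blocks\<close>

lemma measured_descent:
  fixes X :: "'a set" and d :: "'a \<Rightarrow> 'a \<Rightarrow> real" and A B :: real
    and \<phi> :: "int \<Rightarrow> 'a \<Rightarrow> nat \<Rightarrow> real"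
  assumes X: "finite_metric X d" "X \<noteq> {}" and AB: "A \<ge> 1" "B \<ge> 1"
    and \<phi>: "\<And>m. lip_l2 X d 1 (\<phi> m)"
  obtains \<psi> :: "'a \<Rightarrow> nat \<Rightarrow> real" where
    "lip_l2 X d (16 * sqrt (log 2 (real (card X)) * max 1 (log 2 (A * B)))) \<psi>"
    "\<And>x y m. x \<in> X \<Longrightarrow> y \<in> X \<Longrightarrow> 
       sqrt (real_of_int \<lfloor>log 2 (real (card (mball X d x (2 powr (real_of_int m + 1) * A)))
                 / real (card (mball X d x (2 powr m / B))))\<rfloor>)
         * min (2 powr m / B) (l2_dist (\<phi> m x) (\<phi> m y)) \<le> l2_dist (\<psi> x) (\<psi> y)"
proof -
  have fin: "finite X" using X(1) by (simp add: finite_metric_def)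
  have l2: "\<phi> m x \<in> l2_space" if "x \<in> X" for m x using \<phi>[of m] that by (simp add: lip_l2_def)
  have lip: "l2_dist (\<phi> m x) (\<phi> m y) \<le> d x y" if "x \<in> X" "y \<in> X" for m x y
    using \<phi>[of m] that by (simp add: lip_l2_def)
  have lnn: "0 \<le> l2_dist (\<phi> m x) (\<phi> m y)" if "x \<in> X" "y \<in> X" for m x y
    using l2_dist_nonneg l2 that by blast
  have dnn: "0 \<le> d x y" if "x \<in> X" "y \<in> X" for x y
    using lnn[OF that] lip[OF that] by (rule order_trans)
  have sym: "d x y = d y x" if "x \<in> X" "y \<in> X" for x y
    using X(1) that unfolding finite_metric_def by blast
  define T where "T = {t::nat. 2 ^ t < card X}"
  define \<tau> where "\<tau> m = 2 powr real_of_int m / B" for m :: int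
  define \<sigma> where "\<sigma> m = 2 powr (real_of_int m + 1) * A" for m :: int
  have \<tau>: "\<tau> m > 0" for m using AB by (simp add: \<tau>_def)
  have \<tau>\<sigma>: "\<tau> m \<le> \<sigma> m" for m
  proof -
    have "\<tau> m \<le> 2 powr m * 1" using AB by (simp add: \<tau>_def field_simps)
    also have "\<dots> \<le> \<sigma> m" unfolding \<sigma>_def using AB by (intro mult_mono) auto
    finally show ?thesis .
  qed
  have "\<exists>R>0. \<forall>r. R \<le> r \<longleftrightarrow> 2 ^ t < card (mball X d x r)" if "t \<in> T" "x \<in> X" for t x
    using critical_radius[OF X(1) that(2), of "2 ^ t"] that(1) unfolding T_def by auto
  then obtain R where R0: "\<And>t x. t \<in> T \<Longrightarrow> x \<in> X \<Longrightarrow> R t x > 0"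
    and R: "\<And>t x r. t \<in> T \<Longrightarrow> x \<in> X \<Longrightarrow> R t x \<le> r \<longleftrightarrow> 2 ^ t < card (mball X d x r)"
    by metis
  have RL: "\<bar>R t x - R t y\<bar> \<le> d x y" if "t \<in> T" "x \<in> X" "y \<in> X" for t x y
    using critical_radius_lipschitz[OF X(1) that(2,3) R[OF that(1,2)] R[OF that(1,3)]]
      critical_radius_lipschitz[OF X(1) that(3,2) R[OF that(1,3)] R[OF that(1,2)]] sym[OF that(2,3)]
    by linarith
  define a where "a m t x = bump (\<tau> m) (\<sigma> m) (R t x)" for m t x
  define M where "M t x = {m. a m t x \<noteq> 0}" for t x
  have M: "finite (M t x)" "real (card (M t x)) \<le> 5 * max 1 (log 2 (A * B))"
    if "t \<in> T" "x \<in> X" for t x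
    using card_active_scales[OF AB R0[OF that]] by (simp_all add: M_def a_def \<tau>_def \<sigma>_def)
  have finT: "finite T" and cardT: "real (card T) \<le> 2 * log 2 (card X)"
  proof -
    let ?L = "log 2 (card X)"
    have n: "card X \<ge> 1" using fin X(2) by (simp add: Suc_le_eq card_gt_0_iff)
    have sub: "T \<subseteq> {..<nat \<lceil>?L\<rceil>}"
    proof
      fix t assume "t \<in> T"
      hence "2 ^ t < card X" by (simp add: T_def)
      hence "real (2 ^ t) < real (card X)" by (rule of_nat_less_iff[THEN iffD2])
      hence "2 powr t < real (card X)" by (simp add: powr_realpow)
      hence "t < ?L" using n by (simp add: less_log_iff)
      thus "t \<in> {..<nat \<lceil>?L\<rceil>}" by simp linarith
    qed
    thus "finite T" by (rule finite_subset) simp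
    have L0: "0 \<le> ?L" using n by simp
    have c: "card T \<le> nat \<lceil>?L\<rceil>" using card_mono[OF _ sub] by simp
    \<comment> \<open>Rounding up at most doubles log n once n \<ge> 2; for n = 1 both sides are
      0.\<close>
    show "real (card T) \<le> 2 * ?L"
    proof (cases "card X = 1")
      case True thus ?thesis using c by simp
    next
      case False
      hence "1 \<le> ?L" using n by (simp add: le_log_iff)
      thus ?thesis using c by linarith
    qed
  qed
  \<comment> \<open>Only pairs active at some point of \<open>X\<close> are kept: all other blocks
    vanish identically, and the total sum becomes finite.\<close>
  define S where "S = Sigma T (\<lambda>t. \<Union>x\<in>X. M t x)"
  have finS: "finite S" unfolding S_def using finT fin M(1) by (intro finite_SigmaI finite_UN_I)
  define G where "G m x y = exp (- (1 / (\<tau> m)\<^sup>2) * (l2_dist (\<phi> m x) (\<phi> m y))\<^sup>2)" for m x y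
  \<comment> \<open>The factor 2 offsets the loss in \<open>one_minus_exp_ge\<close>, so the lower
    bound holds with constant exactly 1.\<close>
  define K where "K p x y = 2 * ((\<tau> (snd p) * a (snd p) (fst p) x) * (\<tau> (snd p) * a (snd p) (fst p) y)
      * G (snd p) x y)" for p x y
  have "l2_kernel X (\<lambda>x y. \<Sum>p\<in>S. K p x y)"
    unfolding K_def G_def
    by (intro l2_kernel_sum finS l2_kernel_cmult
          l2_kernel_scale[where g = "\<lambda>x. \<tau> m * a m t x" for m t] l2_kernel_gaussian l2) auto
  then obtain \<psi> :: "'a \<Rightarrow> nat \<Rightarrow> real" where \<psi>: "\<And>x. x \<in> X \<Longrightarrow> \<psi> x \<in> l2_space"
    "\<And>x y. x \<in> X \<Longrightarrow> y \<in> X \<Longrightarrow> (l2_dist (\<psi> x) (\<psi> y))\<^sup>2 =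
        (\<Sum>p\<in>S. K p x x) - 2 * (\<Sum>p\<in>S. K p x y) + (\<Sum>p\<in>S. K p y y)"
    by (rule l2_kernel_realize) blast
  \<comment> \<open>The squared distance between the blocks of \<open>x\<close> and
    \<open>y\<close>, using that the Gaussian is 1 on the diagonal.\<close>
  define Q where "Q t m x y = 2 * (\<tau> m)\<^sup>2 * ((a m t x)\<^sup>2 - 2 * (a m t x * a m t y * G m x y) + (a m t y)\<^sup>2)"
    for t m x y
  have \<psi>Q: "(l2_dist (\<psi> x) (\<psi> y))\<^sup>2 = (\<Sum>(t,m)\<in>S. Q t m x y)" if "x \<in> X" "y \<in> X" for x y
  proof -
    have "(l2_dist (\<psi> x) (\<psi> y))\<^sup>2 = (\<Sum>p\<in>S. K p x x - 2 * K p x y + K p y y)"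
      by (simp add: \<psi>(2)[OF that] sum.distrib sum_subtractf sum_distrib_left)
    also have "\<dots> = (\<Sum>(t,m)\<in>S. Q t m x y)"
      by (intro sum.cong) (auto simp: K_def Q_def G_def power2_eq_square algebra_simps)
    finally show ?thesis .
  qed
  have a01: "0 \<le> a m t x" "a m t x \<le> 1" for m t x using bump_range by (simp_all add: a_def)
  have Qup: "Q t m x y \<le> 12 * (d x y)\<^sup>2" if "t \<in> T" "x \<in> X" "y \<in> X" for t m x y
    unfolding Q_def G_def
    by (intro damped_gaussian_upper \<tau> a01 lip lnn that)
       (unfold a_def, intro bump_lipschitz \<tau> \<tau>\<sigma> RL that)
  \<comment> \<open>Nonnegativity lets the lower bound discard all blocks but those of one
    scale.\<close>
  have Qnn: "0 \<le> Q t m x y" for t m x y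
  proof -
    have "G m x y \<le> 1" by (simp add: G_def)
    hence "a m t x * a m t y * G m x y \<le> a m t x * a m t y"
      using a01 by (intro mult_left_le mult_nonneg_nonneg)
    moreover have "0 \<le> (a m t x - a m t y)\<^sup>2" by simp
    ultimately have "0 \<le> (a m t x)\<^sup>2 - 2 * (a m t x * a m t y * G m x y) + (a m t y)\<^sup>2"
      unfolding power2_diff mult.assoc by linarith
    thus ?thesis unfolding Q_def by (intro mult_nonneg_nonneg) auto
  qed
  let ?m = "max 1 (log 2 (A * B))"
  show ?thesis
  proof
    show "lip_l2 X d (16 * sqrt (log 2 (real (card X)) * max 1 (log 2 (A * B)))) \<psi>"
      unfolding lip_l2_def
    proof (intro conjI ballI \<psi>(1))
      fix x y assume xy: "x \<in> X" "y \<in> X"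
      \<comment> \<open>A block inactive at both points contributes 0, so each \<open>t\<close>
        costs at most twice the count of active scales at one point.\<close>
      define P where "P = Sigma T (\<lambda>t. M t x \<union> M t y)"
      have "real (card (M t x \<union> M t y)) \<le> 10 * ?m" if "t \<in> T" for t
        using card_Un_le[of "M t x" "M t y"] M(2)[OF that xy(1)] M(2)[OF that xy(2)] by linarith
      hence "(\<Sum>t\<in>T. real (card (M t x \<union> M t y))) \<le> (\<Sum>t\<in>T. 10 * ?m)" by (intro sum_mono)
      moreover have "real (card P) = (\<Sum>t\<in>T. real (card (M t x \<union> M t y)))"
        unfolding P_def using finT M(1) xy by (subst card_SigmaI) auto
      ultimately have "real (card P) \<le> real (card T) * (10 * ?m)" by simp
      also have "\<dots> \<le> 2 * log 2 (card X) * (10 * ?m)" using cardT by (intro mult_right_mono) auto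
      finally have P: "real (card P) \<le> 20 * (log 2 (card X) * ?m)" by simp
      have nn: "0 \<le> log 2 (card X) * ?m" using P by (smt (verit) of_nat_0_le_iff)
      have "(l2_dist (\<psi> x) (\<psi> y))\<^sup>2 = (\<Sum>(t,m)\<in>P. Q t m x y)"
        unfolding \<psi>Q[OF xy]
        by (rule sum.mono_neutral_right[OF finS]) (use xy in \<open>auto simp: P_def S_def M_def Q_def\<close>)
      also have "\<dots> \<le> (\<Sum>p\<in>P. 12 * (d x y)\<^sup>2)"
        by (intro sum_mono) (use Qup xy in \<open>auto simp: P_def\<close>)
      also have "\<dots> = real (card P) * (12 * (d x y)\<^sup>2)" by simp
      also have "\<dots> \<le> 20 * (log 2 (card X) * ?m) * (12 * (d x y)\<^sup>2)"
        using P by (intro mult_right_mono) auto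
      \<comment> \<open>20 * 12 = 240 is rounded up to 16^2.\<close>
      also have "\<dots> \<le> 256 * (log 2 (card X) * ?m) * (d x y)\<^sup>2"
        using mult_nonneg_nonneg[OF nn, of "(d x y)\<^sup>2"] by (simp add: mult_ac)
      also have "\<dots> = (16 * sqrt (log 2 (card X) * ?m) * d x y)\<^sup>2"
        using nn by (simp only: power_mult_distrib real_sqrt_pow2) simp
      finally show "l2_dist (\<psi> x) (\<psi> y) \<le> 16 * sqrt (log 2 (real (card X)) * ?m) * d x y"
        by (rule power2_le_imp_le) (use nn dnn[OF xy] in auto)
    qed
    fix x y m assume xy: "x \<in> X" "y \<in> X"
    define p where "p = card (mball X d x (\<tau> m))"
    define q where "q = card (mball X d x (\<sigma> m))"
    define N where "N = {t\<in>T. p \<le> 2 ^ t \<and> 2 ^ t < q}"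
    let ?\<mu> = "min (\<tau> m) (l2_dist (\<phi> m x) (\<phi> m y))"
    have finb: "finite (mball X d x r)" for r using fin by (simp add: mball_def)
    have "d x x = 0" using X(1) xy unfolding finite_metric_def by blast
    hence "x \<in> mball X d x (\<tau> m)" "x \<in> mball X d x (\<sigma> m)"
      using xy \<tau>[of m] \<tau>\<sigma>[of m] by (auto simp: mball_def)
    hence "p > 0" "q > 0" using finb by (auto simp: p_def q_def card_gt_0_iff)
    have "q \<le> card X" unfolding q_def by (intro card_mono fin) (auto simp: mball_def)
    have "\<lfloor>log 2 (real q / real p)\<rfloor> \<le> int (card N)"
      by (rule card_powers_between)
         (use \<open>p > 0\<close> \<open>q > 0\<close> \<open>q \<le> card X\<close> finT in \<open>auto simp: N_def T_def\<close>)
    hence card_N: "real_of_int \<lfloor>log 2 (real q / real p)\<rfloor> \<le> real (card N)" by linarith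
    have one: "a m t x = 1" if "t \<in> N" for t
    proof -
      have t: "t \<in> T" "p \<le> 2 ^ t" "2 ^ t < q" using that by (auto simp: N_def)
      \<comment> \<open>\<open>p \<le> 2 ^ t\<close> denies that the ball of radius
        \<open>\<tau> m\<close> is large enough, so that radius lies below the critical one.\<close>
      have "\<tau> m \<le> R t x" using R[OF t(1) xy(1), of "\<tau> m"] t(2) by (simp add: p_def)
      moreover have "R t x \<le> \<sigma> m" using R[OF t(1) xy(1), of "\<sigma> m"] t(3) by (simp add: q_def)
      ultimately show ?thesis unfolding a_def by (intro bump_eq_1 \<tau>)
    qed
    have low: "?\<mu>\<^sup>2 \<le> Q t m x y" if "t \<in> N" for t
      using damped_gaussian_lower[OF \<tau>[of m] a01[of m t y] lnn[OF xy, of m]]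
      by (simp add: Q_def G_def one[OF that])
    have "(sqrt (card N) * ?\<mu>)\<^sup>2 = (\<Sum>t\<in>N. ?\<mu>\<^sup>2)" by (simp add: power_mult_distrib)
    also have "\<dots> \<le> (\<Sum>t\<in>N. Q t m x y)" by (intro sum_mono low)
    also have "\<dots> = (\<Sum>(t,m)\<in>N \<times> {m}. Q t m x y)" by (simp add: sum.cartesian_product[symmetric])
    \<comment> \<open>The pairs lie in \<open>S\<close> because the bump equals 1 at
      \<open>x\<close>.\<close>
    also have "\<dots> \<le> (\<Sum>(t,m)\<in>S. Q t m x y)"
      by (rule sum_mono2[OF finS]) (use one xy Qnn in \<open>auto simp: N_def S_def M_def\<close>)
    also have "\<dots> = (l2_dist (\<psi> x) (\<psi> y))\<^sup>2" by (simp add: \<psi>Q[OF xy])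
    finally have "sqrt (card N) * ?\<mu> \<le> l2_dist (\<psi> x) (\<psi> y)"
      by (rule power2_le_imp_le) (intro l2_dist_nonneg \<psi>(1) xy)
    moreover have "sqrt (real_of_int \<lfloor>log 2 (real q / real p)\<rfloor>) * ?\<mu> \<le> sqrt (card N) * ?\<mu>"
      using card_N \<tau>[of m] lnn[OF xy, of m] by (intro mult_right_mono real_sqrt_le_mono) auto
    ultimately show "sqrt (real_of_int \<lfloor>log 2 (real (card (mball X d x (2 powr (real_of_int m + 1) * A)))
                 / real (card (mball X d x (2 powr m / B))))\<rfloor>)
         * min (2 powr m / B) (l2_dist (\<phi> m x) (\<phi> m y)) \<le> l2_dist (\<psi> x) (\<psi> y)"
      by (simp add: p_def q_def \<tau>_def \<sigma>_def)
  qed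
qed

text \<open>The maximum with 1 covers A = B = 1, where log(AB) = 0: two points at distance 3/2 with
  \<open>\<phi> 0\<close> isometric already force distance 1 at m = 0. Points are natural numbers,
  which is general for finite spaces up to relabelling.\<close>

theorem theorem4p5:
  "\<exists>C::real. C > 0 \<and>
    (\<forall>(X::nat set) d (A::real) (B::real) (\<phi>::int \<Rightarrow> nat \<Rightarrow> nat \<Rightarrow> real).
      finite_metric X d \<and> X \<noteq> {} \<and> A \<ge> 1 \<and> B \<ge> 1 \<and> (\<forall>m. lip_l2 X d 1 (\<phi> m)) \<longrightarrow>
      (\<exists>\<psi>::nat \<Rightarrow> nat \<Rightarrow> real.
         lip_l2 X d (C * sqrt (log 2 (real (card X)) * max 1 (log 2 (A * B)))) \<psi> \<and>
         (\<forall>x\<in>X. \<forall>y\<in>X. \<forall>m::int.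
            l2_dist (\<psi> x) (\<psi> y) \<ge>
              sqrt (real_of_int \<lfloor>log 2 (real (card (mball X d x (2 powr (m + 1) * A)))
                                     / real (card (mball X d x (2 powr m / B))))\<rfloor>)
              * min (2 powr m / B) (l2_dist (\<phi> m x) (\<phi> m y)))))"
proof (intro exI[of _ "16::real"] conjI allI impI)
  fix X :: "nat set" and d and A B :: real and \<phi> :: "int \<Rightarrow> nat \<Rightarrow> nat \<Rightarrow> real"
  assume "finite_metric X d \<and> X \<noteq> {} \<and> A \<ge> 1 \<and> B \<ge> 1 \<and> (\<forall>m. lip_l2 X d 1 (\<phi> m))"
  hence X: "finite_metric X d" "X \<noteq> {}" "A \<ge> 1" "B \<ge> 1" "\<And>m. lip_l2 X d 1 (\<phi> m)" by auto
  show "\<exists>\<psi>::nat \<Rightarrow> nat \<Rightarrow> real.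
         lip_l2 X d (16 * sqrt (log 2 (real (card X)) * max 1 (log 2 (A * B)))) \<psi> \<and>
         (\<forall>x\<in>X. \<forall>y\<in>X. \<forall>m::int.
            l2_dist (\<psi> x) (\<psi> y) \<ge>
              sqrt (real_of_int \<lfloor>log 2 (real (card (mball X d x (2 powr (m + 1) * A)))
                                     / real (card (mball X d x (2 powr m / B))))\<rfloor>)
              * min (2 powr m / B) (l2_dist (\<phi> m x) (\<phi> m y)))"
    by (rule measured_descent[OF X]) (intro exI conjI ballI allI, assumption, simp)
qed simp

end
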